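(* Let $\mathbf u_h\in\mathbf{RT_0}$ be such that $\mathrm{div}\,\mathbf u_h\ge0$. Then for all $\mathbf v_h\in\mathbf P_0$ we have $$\mathrm b_h(\mathbf u_h,\mathbf v_h,\mathbf v_h)\ge0 .$$
   Context: $\Omega\subset\mathbb R^2$ is a bounded polygonal domain. $\mathcal T_h$ is a conforming triangular mesh of $\Omega$ whose triangles have all interior angles less than $\pi/2$. For $K\in\mathcal T_h$, $|K|$ is its area, $\mathcal E_K$ the set of its edges, $\mathbf n_{K,\sigma}$ the unit normal to $\sigma\in\mathcal E_K$ pointing outward from $K$. $\mathcal E_h^{int}$ is the set of edges inside $\Omega$, $|\sigma|$ is the length of $\sigma$. For $\sigma\in\mathcal E_h^{int}$, $K_\sigma,L_\sigma$ are the two triangles sharing $\sigma$; when a triangle $K$ having $\sigma$ as an edge is singled out, $L_\sigma$ is the other one. $\mathbf P_0$: $\mathbb R^2$-valued functions constant on each $K\in\mathcal T_h$, with $\mathbf v_K=\mathbf v_h|_K$. $\mathbf{RT_0}$: vector fields $\mathbf v_h$, affine on each triangle, such that $\mathbf v_h|_K\cdot\mathbf n_{K,\sigma}$ is constant on $\sigma$ for all $K$ and $\sigma\in\mathcal E_K$, $\mathbf v_h\cdot\mathbf n=0$ on $\partial\Omega$, and $\mathbf v_h|_{K_\sigma}\cdot\mathbf n_{K_\sigma,\sigma}=\mathbf v_h|_{L_\sigma}\cdot\mathbf n_{K_\sigma,\sigma}$ on every $\sigma\in\mathcal E_h^{int}$; one writes $(\mathbf v_h\cdot\mathbf n_{K,\sigma})_\sigma=\mathbf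 v_h|_K\cdot\mathbf n_{K,\sigma}$. With $a^+=\max(a,0)$, $a^-=\min(a,0)$, $\tilde{\mathbf b}_h:\mathbf{RT_0}\times\mathbf P_0\to\mathbf P_0$ is $$\tilde{\mathbf b}_h(\mathbf u_h,\mathbf v_h)|_K=\frac1{|K|}\sum_{\sigma\in\mathcal E_K\cap\mathcal E_h^{int}}|\sigma|\big((\mathbf u_h\cdot\mathbf n_{K,\sigma})_\sigma^+\mathbf v_K+(\mathbf u_h\cdot\mathbf n_{K,\sigma})_\sigma^-\mathbf v_{L_\sigma}\big),$$ and $\mathrm b_h:\mathbf{RT_0}\times\mathbf P_0\times\mathbf P_0\to\mathbb R$ is $\mathrm b_h(\mathbf u_h,\mathbf v_h,\mathbf w_h)=\sum_{K\in\mathcal T_h}|K|\,\mathbf w_K\cdot\tilde{\mathbf b}_h(\mathbf u_h,\mathbf v_h)|_K$. *)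

theory Defs
  imports "HOL-Analysis.Analysis"
begin

type_synonym plane = "real ^ 2"

section \<open>Polygonal domains and acute conforming meshes\<close>

(* Neither simple connectedness nor a Lipschitz boundary is required. *)
definition polygonal_domain :: "plane set \<Rightarrow> bool" where
  "polygonal_domain \<Omega> \<longleftrightarrow>
     open \<Omega> \<and> connected \<Omega> \<and> \<Omega> \<noteq> {} \<and>
     (\<exists>S. finite S \<and> frontier \<Omega> = \<Union>S \<and>
          (\<forall>s\<in>S. \<exists>a b. a \<noteq> b \<and> s = closed_segment a b))"

(* Interior angle at the vertex a of the triangle a b c. *)
definition angle_at :: "plane \<Rightarrow> plane \<Rightarrow> plane \<Rightarrow> real" where
  "angle_at a b c = arccos (((b - a) \<bullet> (c - a)) / (norm (b - a) * norm (c - a)))"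

definition acute_triangle :: "plane set \<Rightarrow> bool" where
  "acute_triangle K \<longleftrightarrow>
     2 simplex K \<and>
     (\<forall>a b c. a extreme_point_of K \<and> b extreme_point_of K \<and> c extreme_point_of K \<and>
        a \<noteq> b \<and> a \<noteq> c \<and> b \<noteq> c \<longrightarrow> angle_at a b c < pi / 2)"

(* Triangles are closed sets. Conformity is part of the library's triangulation: the
   intersection of two members is a face (possibly empty) of both.
   The condition on interiors says that the elements lie in the domain itself; it only
   matters when the domain is not the interior of its closure (e.g. a slit domain). *)
definition acute_mesh :: "plane set \<Rightarrow> plane set set \<Rightarrow> bool" where
  "acute_mesh \<Omega> T \<longleftrightarrow>
     triangulation T \<and> \<Union>T = closure \<Omega> \<and>
     (\<forall>K\<in>T. acute_triangle K \<and> interior K \<subseteq> \<Omega>)"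

definition edges :: "plane set \<Rightarrow> plane set set" where
  "edges K = {\<sigma>. \<sigma> edge_of K}"

(* The relative interior of an edge is the edge without its endpoints. *)
definition interior_edges :: "plane set \<Rightarrow> plane set set \<Rightarrow> plane set set" where
  "interior_edges \<Omega> T = {\<sigma>. (\<exists>K\<in>T. \<sigma> \<in> edges K) \<and> rel_interior \<sigma> \<subseteq> \<Omega>}"

definition area :: "plane set \<Rightarrow> real" where
  "area K = measure lebesgue K"

(* An edge is a segment, so its diameter is its length. *)
definition edge_length :: "plane set \<Rightarrow> real" where
  "edge_length \<sigma> = diameter \<sigma>"

definition outer_normal :: "plane set \<Rightarrow> plane set \<Rightarrow> plane" where
  "outer_normal K \<sigma> =
     (THE n. norm n = 1 \<and> (\<forall>x\<in>\<sigma>. \<forall>y\<in>\<sigma>. n \<bullet> (x - y) = 0) \<and>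
             (\<forall>x\<in>K. \<forall>y\<in>\<sigma>. n \<bullet> (x - y) \<le> 0))"

(* The triangle L_\<sigma> on the other side of an interior edge \<sigma> of K. *)
definition neighbour :: "plane set set \<Rightarrow> plane set \<Rightarrow> plane set \<Rightarrow> plane set" where
  "neighbour T K \<sigma> = (THE L. L \<in> T \<and> L \<noteq> K \<and> \<sigma> \<in> edges L)"


section \<open>Discrete spaces\<close>

(* Piecewise polynomial fields are total functions on the plane that are only constrained on
   the interiors of the triangles: adjacent closed triangles overlap, so the values on
   edges carry no information. The restriction of a field to a closed triangle K is the
   polynomial determined by its values on the interior of K. *)

definition P0 :: "plane set set \<Rightarrow> (plane \<Rightarrow> plane) set" where
  "P0 T = {v. \<forall>K\<in>T. \<exists>c. \<forall>x\<in>interior K. v x = c}"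

definition cell_value :: "(plane \<Rightarrow> plane) \<Rightarrow> plane set \<Rightarrow> plane" where
  "cell_value v K = (THE c. \<forall>x\<in>interior K. v x = c)"

definition affine_map :: "(plane \<Rightarrow> plane) \<Rightarrow> bool" where
  "affine_map g \<longleftrightarrow> (\<exists>A b. linear A \<and> (\<forall>x. g x = A x + b))"

definition cell_restr :: "(plane \<Rightarrow> plane) \<Rightarrow> plane set \<Rightarrow> plane \<Rightarrow> plane" where
  "cell_restr u K = (THE g. affine_map g \<and> (\<forall>x\<in>interior K. u x = g x))"

(* The condition on the boundary of \<Omega> is imposed away from the endpoints of the edges, where
   the normal is not defined. *)
definition RT0 :: "plane set \<Rightarrow> plane set set \<Rightarrow> (plane \<Rightarrow> plane) set" where
  "RT0 \<Omega> T = {u.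
     (\<forall>K\<in>T. \<exists>g. affine_map g \<and> (\<forall>x\<in>interior K. u x = g x)) \<and>
     (\<forall>K\<in>T. \<forall>\<sigma>\<in>edges K. \<exists>c. \<forall>x\<in>\<sigma>. cell_restr u K x \<bullet> outer_normal K \<sigma> = c) \<and>
     (\<forall>K\<in>T. \<forall>\<sigma>\<in>edges K. \<forall>x\<in>rel_interior \<sigma> \<inter> frontier \<Omega>.
        cell_restr u K x \<bullet> outer_normal K \<sigma> = 0) \<and>
     (\<forall>K\<in>T. \<forall>\<sigma>\<in>edges K \<inter> interior_edges \<Omega> T. \<forall>x\<in>\<sigma>.
        cell_restr u K x \<bullet> outer_normal K \<sigma> =
        cell_restr u (neighbour T K \<sigma>) x \<bullet> outer_normal K \<sigma>)}"

(* The constant value of the normal component on the edge \<sigma> of K. *)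
definition normal_comp :: "(plane \<Rightarrow> plane) \<Rightarrow> plane set \<Rightarrow> plane set \<Rightarrow> real" where
  "normal_comp u K \<sigma> = (THE c. \<forall>x\<in>\<sigma>. cell_restr u K x \<bullet> outer_normal K \<sigma> = c)"

definition divergence :: "(plane \<Rightarrow> plane) \<Rightarrow> plane \<Rightarrow> real" where
  "divergence u x = (\<Sum>i\<in>UNIV. frechet_derivative u (at x) (axis i 1) $ i)"

(* Normal components of RT0 fields are continuous across interior edges, so the weak divergence
   on \<Omega> is the piecewise constant function given by the classical one in each triangle. *)
definition div_nonneg :: "plane set set \<Rightarrow> (plane \<Rightarrow> plane) \<Rightarrow> bool" where
  "div_nonneg T u \<longleftrightarrow> (\<forall>K\<in>T. \<forall>x\<in>interior K. divergence u x \<ge> 0)"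


section \<open>The upwind convection operator and form\<close>

(* The value on the triangle K of the P0 field. The negative part is min a 0, hence nonpositive. *)
definition upwind_conv ::
  "plane set \<Rightarrow> plane set set \<Rightarrow> (plane \<Rightarrow> plane) \<Rightarrow> (plane \<Rightarrow> plane) \<Rightarrow> plane set \<Rightarrow> plane" where
  "upwind_conv \<Omega> T u v K =
     (1 / area K) *\<^sub>R
     (\<Sum>\<sigma>\<in>edges K \<inter> interior_edges \<Omega> T.
        edge_length \<sigma> *\<^sub>R
          (max (normal_comp u K \<sigma>) 0 *\<^sub>R cell_value v K +
           min (normal_comp u K \<sigma>) 0 *\<^sub>R cell_value v (neighbour T K \<sigma>)))"

definition upwind_form ::
  "plane set \<Rightarrow> plane set set \<Rightarrow> (plane \<Rightarrow> plane) \<Rightarrow> (plane \<Rightarrow> plane) \<Rightarrow> (plane \<Rightarrow> plane) \<Rightarrow> real" where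
  "upwind_form \<Omega> T u v w = (\<Sum>K\<in>T. area K * (cell_value w K \<bullet> upwind_conv \<Omega> T u v K))"

end

theory Submission
  imports Defs
begin

text \<open>With \<open>f\<close> the flux through an edge \<open>\<sigma>\<close> of \<open>K\<close>, the inequality \<open>2 p \<bullet> q \<le> p \<bullet> p + q \<bullet> q\<close> bounds each
  term of the form below by half of \<open>f \<bar>v\<^sub>K\<bar>\<^sup>2 + f\<^sup>+ \<bar>v\<^sub>K\<bar>\<^sup>2 + f\<^sup>- \<bar>v\<^sub>L\<bar>\<^sup>2\<close>. The last two contributions
  cancel in the sum over all pairs \<open>(K, \<sigma>)\<close>, because exchanging the two triangles at \<open>\<sigma>\<close> reverses
  the flux. The first ones add up to \<open>\<bar>v\<^sub>K\<bar>\<^sup>2\<close> times the total flux out of \<open>K\<close>, which is nonnegative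
  by the divergence theorem; for an affine field on a triangle this is an algebraic identity.\<close>

section \<open>Oriented area and outer normals of triangles\<close>

text \<open>The determinant with columns \<open>x\<close> and \<open>y\<close>. Thus
  \<open>cross2 (b - a) (c - a)\<close> is twice the oriented area of the triangle
  \<open>a b c\<close>, and its sign tells on which side of the line \<open>a b\<close> the point
  \<open>c\<close> lies.\<close>

definition cross2 :: "plane \<Rightarrow> plane \<Rightarrow> real" where
  "cross2 x y = x $ 1 * y $ 2 - x $ 2 * y $ 1"

text \<open>The clockwise quarter turn. In a triangle \<open>a b c\<close> listed counterclockwise,
  \<open>rot (b - a)\<close> points outward across the edge \<open>a b\<close>.\<close>

definition rot :: "plane \<Rightarrow> plane" where
  "rot x = vector [x $ 2, - x $ 1]"

lemma rot_nth [simp]: "rot x $ 1 = x $ 2" "rot x $ 2 = - x $ 1"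
  by (simp_all add: rot_def)

lemma inner_plane: "x \<bullet> y = x $ 1 * y $ 1 + x $ 2 * y $ 2" for x y :: plane
  by (simp add: inner_vec_def sum_2)

lemma inner_rot: "rot x \<bullet> y = - cross2 x y"
  by (simp add: inner_plane cross2_def)

lemma norm_rot [simp]: "norm (rot x) = norm x"
  by (simp add: norm_eq_sqrt_inner inner_plane)

lemma cross2_eq_0_iff_collinear:
  "cross2 (b - a) (c - a) = 0 \<longleftrightarrow> collinear {a, b, c}"
proof -
  have *: "cross2 x y = 0 \<longleftrightarrow> x = 0 \<or> y = 0 \<or> (\<exists>t. y = t *\<^sub>R x)" for x y
  proof
    assume z: "cross2 x y = 0"
    show "x = 0 \<or> y = 0 \<or> (\<exists>t. y = t *\<^sub>R x)"
    proof (cases "x $ 1 = 0")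
      case True
      show ?thesis
      proof (cases "x $ 2 = 0")
        case False
        then have "y = (y $ 2 / x $ 2) *\<^sub>R x"
          using True z by (simp add: vec_eq_iff forall_2 cross2_def)
        then show ?thesis by blast
      qed (use True in \<open>simp add: vec_eq_iff forall_2\<close>)
    next
      case False
      then have "y = (y $ 1 / x $ 1) *\<^sub>R x"
        using z by (simp add: vec_eq_iff forall_2 cross2_def field_simps)
      then show ?thesis by blast
    qed
  qed (auto simp: cross2_def)
  \<comment> \<open>\<open>collinear_3\<close> subtracts the middle point, so \<open>a\<close> is
    moved there first.\<close>
  have "collinear {a, b, c} \<longleftrightarrow> collinear {b, a, c}"
    by (simp add: insert_commute)
  also have "\<dots> \<longleftrightarrow> collinear {0, b - a, c - a}"
    by (rule collinear_3) (simp add: NO_MATCH_def)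
  finally show ?thesis
    by (simp add: * collinear_lemma)
qed

text \<open>In the plane the orthogonal complement of \<open>w\<close> is the line spanned by
  \<open>rot w\<close>, and a line contains two unit vectors. This leaves two candidates for a
  normal.\<close>

lemma plane_orthogonal_unit:
  assumes "norm n = 1" "n \<bullet> w = 0" "w \<noteq> 0"
  shows "n = (1 / norm w) *\<^sub>R rot w \<or> n = - (1 / norm w) *\<^sub>R rot w"
proof -
  \<comment> \<open>The coefficient of the projection of \<open>n\<close> onto \<open>rot w\<close>,
    as \<open>n \<bullet> rot w = cross2 n w\<close>.\<close>
  define s where "s = cross2 n w / (norm w)\<^sup>2"
  have nw: "(norm w)\<^sup>2 = w $ 1 * w $ 1 + w $ 2 * w $ 2"
    by (simp add: power2_norm_eq_inner inner_plane)
  have pos: "w $ 1 * w $ 1 + w $ 2 * w $ 2 \<noteq> 0"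
    using assms(3) nw by (metis norm_eq_zero power_eq_0_iff)
  have o: "n $ 2 * w $ 2 = - (n $ 1 * w $ 1)"
    using assms(2) by (simp add: inner_plane)
  have "n $ 1 * (w $ 1 * w $ 1 + w $ 2 * w $ 2) = cross2 n w * w $ 2"
    using o unfolding cross2_def by algebra
  moreover have "n $ 2 * (w $ 1 * w $ 1 + w $ 2 * w $ 2) = - (cross2 n w * w $ 1)"
    using o unfolding cross2_def by algebra
  ultimately have n: "n = s *\<^sub>R rot w"
    unfolding s_def nw using pos
    by (simp add: vec_eq_iff forall_2 field_simps)
  then have "\<bar>s\<bar> * norm w = 1"
    using assms(1) by (metis norm_scaleR norm_rot)
  then have "\<bar>s\<bar> = 1 / norm w"
    using assms(3) by (simp add: field_simps)
  then have "s = 1 / norm w \<or> s = - (1 / norm w)"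
    by linarith
  then show ?thesis
    using n by auto
qed

lemma convex_hull_3_halfspace:
  assumes "n \<bullet> (c - a) \<le> 0" "n \<bullet> (b - a) = 0" "x \<in> convex hull {a, b, c}"
  shows "n \<bullet> (x - a) \<le> (0::real)"
proof -
  have "convex {x. n \<bullet> x \<le> n \<bullet> a}"
    by (rule convex_halfspace_le)
  moreover have "{a, b, c} \<subseteq> {x. n \<bullet> x \<le> n \<bullet> a}"
    using assms by (auto simp: inner_diff_right)
  ultimately have "convex hull {a, b, c} \<subseteq> {x. n \<bullet> x \<le> n \<bullet> a}"
    by (rule hull_minimal[rotated])
  then show ?thesis
    using assms(3) by (auto simp: inner_diff_right)
qed

text \<open>Replaces the definite description by a formula. The factor \<open>sgn D\<close> turns
  the vector away from \<open>c\<close> for either orientation of the vertices.\<close>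

lemma outer_normal_triangle:
  fixes a b c :: plane
  defines "D \<equiv> cross2 (b - a) (c - a)"
  assumes "D \<noteq> 0"
  shows "outer_normal (convex hull {a, b, c}) (closed_segment a b) =
    (sgn D / norm (b - a)) *\<^sub>R rot (b - a)"
proof -
  let ?w = "b - a"
  let ?n = "(sgn D / norm ?w) *\<^sub>R rot ?w"
  have w: "?w \<noteq> 0"
    using assms by (auto simp: cross2_def)
  have seg: "n \<bullet> (x - a) = 0" if "n \<bullet> ?w = 0" "x \<in> closed_segment a b" for n x
  proof -
    obtain t where "x = (1 - t) *\<^sub>R a + t *\<^sub>R b"
      using \<open>x \<in> _\<close> by (auto simp: in_segment)
    then have "x - a = t *\<^sub>R ?w" by (simp add: algebra_simps)
    then show ?thesis using \<open>n \<bullet> ?w = 0\<close> by simp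
  qed
  have orth: "?n \<bullet> ?w = 0"
    by (simp add: inner_rot cross2_def)
  have neg: "?n \<bullet> (c - a) < 0"
    using w assms by (simp add: inner_rot sgn_if divide_simps)
  show ?thesis
    unfolding outer_normal_def
  proof (rule the_equality)
    have "norm ?n = 1"
      using w assms by (simp add: abs_sgn_eq)
    moreover have "?n \<bullet> (x - y) = 0" if "x \<in> closed_segment a b" "y \<in> closed_segment a b" for x y
      using seg[OF orth that(1)] seg[OF orth that(2)] unfolding inner_diff_right by linarith
    moreover have "?n \<bullet> (x - y) \<le> 0"
      if "x \<in> convex hull {a, b, c}" "y \<in> closed_segment a b" for x y
      using convex_hull_3_halfspace[OF less_imp_le[OF neg] orth that(1)] seg[OF orth that(2)]
      unfolding inner_diff_right by linarith
    ultimately show "norm ?n = 1 \<and>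
      (\<forall>x\<in>closed_segment a b. \<forall>y\<in>closed_segment a b. ?n \<bullet> (x - y) = 0) \<and>
      (\<forall>x\<in>convex hull {a, b, c}. \<forall>y\<in>closed_segment a b. ?n \<bullet> (x - y) \<le> 0)"
      by blast
  next
    fix n assume n: "norm n = 1 \<and>
      (\<forall>x\<in>closed_segment a b. \<forall>y\<in>closed_segment a b. n \<bullet> (x - y) = 0) \<and>
      (\<forall>x\<in>convex hull {a, b, c}. \<forall>y\<in>closed_segment a b. n \<bullet> (x - y) \<le> 0)"
    then have "n \<bullet> ?w = 0" by blast
    with n w have cases: "n = (1 / norm ?w) *\<^sub>R rot ?w \<or> n = - (1 / norm ?w) *\<^sub>R rot ?w"
      by (intro plane_orthogonal_unit) auto
    \<comment> \<open>The vertex \<open>c\<close> decides between the two signs, since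
      \<open>D \<noteq> 0\<close> keeps it off the line through \<open>a\<close> and
      \<open>b\<close>.\<close>
    have "c \<in> convex hull {a, b, c}" by (rule hull_inc) simp
    with n have "n \<bullet> (c - a) \<le> 0" by auto
    with cases show "n = ?n"
      using w assms by (auto simp: inner_rot sgn_if divide_simps split: if_splits)
  qed
qed

section \<open>Edge lengths and the flux identity on a triangle\<close>

lemma edge_length_segment [simp]: "edge_length (closed_segment a b) = norm (b - a)"
  unfolding edge_length_def
proof (rule antisym)
  show "diameter (closed_segment a b) \<le> norm (b - a)"
  proof (rule diameter_le)
    fix x y assume "x \<in> closed_segment a b" "y \<in> closed_segment a b"
    then obtain s t where s: "x = (1 - s) *\<^sub>R a + s *\<^sub>R b" "0 \<le> s" "s \<le> 1"
      and t: "y = (1 - t) *\<^sub>R a + t *\<^sub>R b" "0 \<le> t" "t \<le> 1"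
      by (auto simp: in_segment)
    have "x - y = (s - t) *\<^sub>R (b - a)"
      unfolding s t by (simp add: algebra_simps)
    then have "norm (x - y) = \<bar>s - t\<bar> * norm (b - a)"
      by simp
    also have "\<dots> \<le> 1 * norm (b - a)"
      using s t by (intro mult_right_mono) auto
    finally show "norm (x - y) \<le> norm (b - a)" by simp
  qed simp
  show "norm (b - a) \<le> diameter (closed_segment a b)"
    using diameter_bounded_bound[of "closed_segment a b" b a]
    by (simp add: dist_norm bounded_closed_segment)
qed

text \<open>The divergence theorem for an affine field: the midpoint rule is exact on each edge, so
  \<open>f\<close> is the flux through an edge, and the right side is the area times the trace of
  \<open>A\<close>. With explicit normals it becomes a polynomial identity in coordinates.\<close>

lemma triangle_flux:
  assumes "linear A" "\<And>x. g x = A x + z" "cross2 (b - a) (c - a) \<noteq> 0"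
    and "f = (\<lambda>p q r. edge_length (closed_segment p q) *
      (g (midpoint p q) \<bullet> outer_normal (convex hull {p, q, r}) (closed_segment p q)))"
  shows "f a b c + f b c a + f c a b =
    \<bar>cross2 (b - a) (c - a)\<bar> / 2 * (A (axis 1 1) $ 1 + A (axis 2 1) $ 2)"
proof -
  let ?D = "cross2 (b - a) (c - a)"
  \<comment> \<open>The edge length cancels the normalization of the outer normal.\<close>
  have f: "f p q r = sgn (cross2 (q - p) (r - p)) * (g (midpoint p q) \<bullet> rot (q - p))"
    if "cross2 (q - p) (r - p) \<noteq> 0" for p q r
  proof -
    have "q - p \<noteq> 0" using that by (auto simp: cross2_def)
    then show ?thesis
      using that by (simp add: assms(4) outer_normal_triangle)
  qed
  \<comment> \<open>Cyclic relabelling keeps the oriented area, so one common sign factors out of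
    the three fluxes.\<close>
  have c1: "cross2 (c - b) (a - b) = ?D" and c2: "cross2 (a - c) (b - c) = ?D"
    by (simp_all add: cross2_def algebra_simps)
  have A: "A x $ i = x $ 1 * A (axis 1 1) $ i + x $ 2 * A (axis 2 1) $ i" for x i
  proof -
    have "x = x $ 1 *\<^sub>R axis 1 1 + x $ 2 *\<^sub>R axis 2 1"
      by (simp add: vec_eq_iff forall_2 axis_def)
    then have "A x = A (x $ 1 *\<^sub>R axis 1 1 + x $ 2 *\<^sub>R axis 2 1)"
      by (rule arg_cong)
    also have "\<dots> = x $ 1 *\<^sub>R A (axis 1 1) + x $ 2 *\<^sub>R A (axis 2 1)"
      by (simp only: linear_add[OF assms(1)] linear_scale[OF assms(1)])
    finally have "A x = x $ 1 *\<^sub>R A (axis 1 1) + x $ 2 *\<^sub>R A (axis 2 1)" .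
    then show ?thesis by simp
  qed
  have m: "midpoint p q $ i = (p $ i + q $ i) / 2" for p q :: plane and i
    by (simp add: midpoint_def field_simps)
  have "f a b c + f b c a + f c a b =
    sgn ?D * (g (midpoint a b) \<bullet> rot (b - a) + g (midpoint b c) \<bullet> rot (c - b) +
      g (midpoint c a) \<bullet> rot (a - c))"
    using assms(3) by (simp add: f c1 c2 algebra_simps)
  also have "g (midpoint a b) \<bullet> rot (b - a) + g (midpoint b c) \<bullet> rot (c - b) +
      g (midpoint c a) \<bullet> rot (a - c) = ?D / 2 * (A (axis 1 1) $ 1 + A (axis 2 1) $ 2)"
    unfolding assms(2) inner_plane
    by (simp add: A[of "midpoint _ _"] m cross2_def field_simps)
  finally show ?thesis
    by (simp add: abs_sgn)
qed


section \<open>Triangles and edges of a mesh\<close>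

lemma acute_triangle_imp_vertices:
  assumes "acute_triangle K"
  obtains a b c where "K = convex hull {a, b, c}" "cross2 (b - a) (c - a) \<noteq> 0"
proof -
  obtain C where C: "\<not> affine_dependent C" "int (card C) = 2 + 1" "K = convex hull C"
    using assms unfolding acute_triangle_def simplex_def by auto
  then have "card C = 3" by simp
  then obtain a b c where "C = {a, b, c}" "a \<noteq> b" "b \<noteq> c" "a \<noteq> c"
    by (auto simp: card_3_iff)
  then show ?thesis
    using that C by (auto simp: cross2_eq_0_iff_collinear collinear_3_eq_affine_dependent)
qed

lemma affine_independent_triangle:
  assumes "cross2 (b - a) (c - a) \<noteq> 0"
  shows "\<not> affine_dependent {a, b, c}" "a \<noteq> b" "b \<noteq> c" "a \<noteq> c"
  using assms by (auto simp: cross2_eq_0_iff_collinear collinear_3_eq_affine_dependent)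

text \<open>Faces of the hull of affinely independent points are the hulls of subsets; dimension one
  selects the subsets with two elements.\<close>

lemma edges_triangle:
  assumes "cross2 (b - a) (c - a) \<noteq> 0"
  shows "edges (convex hull {a, b, c}) =
    {closed_segment a b, closed_segment b c, closed_segment c a}"
proof -
  note ind = affine_independent_triangle[OF assms]
  have "\<sigma> \<in> edges (convex hull {a, b, c}) \<longleftrightarrow>
      (\<exists>C\<subseteq>{a, b, c}. \<sigma> = convex hull C \<and> card C = 2)" for \<sigma>
  proof -
    have "aff_dim (convex hull C) = int (card C) - 1" if "C \<subseteq> {a, b, c}" for C
      using aff_dim_affine_independent[OF affine_independent_subset[OF ind(1) that]]
      by (simp add: aff_dim_convex_hull)
    then show ?thesis
      unfolding edges_def edge_of_def
      using face_of_convex_hull_affine_independent[OF ind(1)] by auto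
  qed
  also have "(\<exists>C\<subseteq>{a, b, c}. \<sigma> = convex hull C \<and> card C = 2) \<longleftrightarrow>
    \<sigma> \<in> {closed_segment a b, closed_segment b c, closed_segment c a}" for \<sigma>
  proof -
    have "C \<subseteq> {a, b, c} \<and> card C = 2 \<longleftrightarrow> C \<in> {{a, b}, {b, c}, {c, a}}" for C
    proof
      assume C: "C \<subseteq> {a, b, c} \<and> card C = 2"
      then obtain x y where "C = {x, y}" "x \<noteq> y" by (auto simp: card_2_iff)
      with C show "C \<in> {{a, b}, {b, c}, {c, a}}" by auto
    qed (use ind in auto)
    then show ?thesis
      unfolding segment_convex_hull insert_iff empty_iff by metis
  qed
  finally show ?thesis by blast
qed

text \<open>By cyclic relabelling, an arbitrary edge may be taken to be the one opposite
  \<open>c\<close>.\<close>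

lemma acute_triangle_edge:
  assumes "acute_triangle K" "\<sigma> \<in> edges K"
  obtains a b c where "K = convex hull {a, b, c}" "\<sigma> = closed_segment a b"
    "cross2 (b - a) (c - a) \<noteq> 0"
proof -
  obtain a b c where K: "K = convex hull {a, b, c}" and D: "cross2 (b - a) (c - a) \<noteq> 0"
    using assms(1) by (rule acute_triangle_imp_vertices)
  have "{b, c, a} = {a, b, c}" "{c, a, b} = {a, b, c}" by auto
  moreover have "cross2 (c - b) (a - b) \<noteq> 0" "cross2 (a - c) (b - c) \<noteq> 0"
    using D by (simp_all add: cross2_def algebra_simps)
  ultimately show ?thesis
    using assms(2) K D edges_triangle[OF D] that by (metis insert_iff empty_iff)
qed

text \<open>If \<open>c\<close> and \<open>d\<close> lay on the same side, the median from \<open>c\<close> would enter the other triangle.\<close>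

lemma adjacent_triangles_opposite_sides:
  fixes a b c d :: plane
  assumes c: "cross2 (b - a) (c - a) \<noteq> 0" and d: "cross2 (b - a) (d - a) \<noteq> 0"
    and int: "convex hull {a, b, c} \<inter> convex hull {a, b, d} \<subseteq> closed_segment a b"
  shows "cross2 (b - a) (c - a) * cross2 (b - a) (d - a) < 0"
proof (rule ccontr)
  let ?C = "cross2 (b - a) (c - a)" and ?D = "cross2 (b - a) (d - a)"
  assume "\<not> ?C * ?D < 0"
  with c d have "?C * ?D > 0"
    by (metis mult_eq_0_iff linorder_less_linear)
  \<comment> \<open>\<open>\<alpha>\<close> and \<open>\<beta>\<close> are given by Cramer's rule:
    the coordinates of \<open>c - a\<close> in the basis \<open>b - a\<close>,
    \<open>d - a\<close>.\<close>
  define \<beta> where "\<beta> = ?C / ?D"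
  define \<alpha> where "\<alpha> = cross2 (c - a) (d - a) / ?D"
  have \<beta>: "\<beta> > 0"
    using \<open>?C * ?D > 0\<close> by (simp add: \<beta>_def zero_less_divide_iff zero_less_mult_iff)
  have ca: "c - a = \<alpha> *\<^sub>R (b - a) + \<beta> *\<^sub>R (d - a)"
  proof -
    have "?D *\<^sub>R (c - a) = cross2 (c - a) (d - a) *\<^sub>R (b - a) + ?C *\<^sub>R (d - a)"
      by (simp add: vec_eq_iff forall_2 cross2_def algebra_simps)
    then have "(1 / ?D) *\<^sub>R (?D *\<^sub>R (c - a)) =
      (1 / ?D) *\<^sub>R (cross2 (c - a) (d - a) *\<^sub>R (b - a) + ?C *\<^sub>R (d - a))"
      by simp
    then show ?thesis
      using d by (simp add: \<alpha>_def \<beta>_def scaleR_add_right)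
  qed
  \<comment> \<open>Small enough that moving from the midpoint of \<open>a b\<close> a fraction
    \<open>t\<close> of the way to \<open>c\<close> keeps the barycentric coordinates with respect
    to \<open>a\<close>, \<open>b\<close>, \<open>d\<close> nonnegative.\<close>
  define t where "t = 1 / (4 * (1 + \<bar>\<alpha>\<bar> + \<beta>))"
  have t: "0 < t" "t * (1 + \<bar>\<alpha>\<bar> + \<beta>) = 1 / 4"
    using \<beta> by (simp_all add: t_def field_simps add_pos_nonneg)
  then have te: "t + t * \<bar>\<alpha>\<bar> + t * \<beta> = 1 / 4"
    by (simp add: algebra_simps)
  have ta: "t * \<bar>\<alpha>\<bar> \<ge> 0" "t * \<beta> > 0" "\<bar>t * \<alpha>\<bar> = t * \<bar>\<alpha>\<bar>"
    using t \<beta> by (simp_all add: abs_mult)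
  define x where "x = ((1 - t) / 2) *\<^sub>R a + ((1 - t) / 2) *\<^sub>R b + t *\<^sub>R c"
  have "x \<in> convex hull {a, b, c}"
    unfolding convex_hull_3 x_def using t te ta
    by (intro CollectI exI[of _ "(1 - t) / 2"] exI[of _ t]) (auto simp: field_simps)
  moreover have "x = (1 / 2 + t / 2 - t * \<alpha> - t * \<beta>) *\<^sub>R a
      + (1 / 2 - t / 2 + t * \<alpha>) *\<^sub>R b + (t * \<beta>) *\<^sub>R d"
  proof -
    have "x = a + ((1 - t) / 2) *\<^sub>R (b - a) + t *\<^sub>R (c - a)"
      by (simp add: x_def vec_eq_iff field_simps)
    then show ?thesis
      unfolding ca by (simp add: vec_eq_iff algebra_simps field_simps)
  qed
  then have "x \<in> convex hull {a, b, d}"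
    unfolding convex_hull_3 using t te ta
    by (intro CollectI exI[of _ "1 / 2 + t / 2 - t * \<alpha> - t * \<beta>"]
        exI[of _ "1 / 2 - t / 2 + t * \<alpha>"] exI[of _ "t * \<beta>"]) linarith
  ultimately have "x \<in> closed_segment a b"
    using int by blast
  then obtain s where "x = (1 - s) *\<^sub>R a + s *\<^sub>R b"
    by (auto simp: in_segment)
  then have "x - a = s *\<^sub>R (b - a)"
    by (simp add: algebra_simps)
  then have "cross2 (b - a) (x - a) = 0"
    by (simp add: cross2_def)
  \<comment> \<open>The point \<open>x\<close> has moved off the line \<open>a b\<close> by a
    nonzero amount.\<close>
  moreover have "cross2 (b - a) (x - a) = t * ?C"
    by (simp add: x_def cross2_def field_simps)
  ultimately show False
    using t c by simp
qed

section \<open>Intersections of mesh elements and the triangle across an edge\<close>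

lemma mesh_intersection_face:
  assumes "acute_mesh \<Omega> T" "K \<in> T" "L \<in> T"
  shows "K \<inter> L face_of K" "K \<inter> L face_of L"
proof -
  have face: "M \<inter> N face_of M" if "M \<in> T" "N \<in> T" for M N
    using assms(1) that by (simp add: acute_mesh_def triangulation_def)
  show "K \<inter> L face_of K" "K \<inter> L face_of L"
    using face[OF assms(2,3)] face[OF assms(3,2)] by (simp_all add: Int_commute)
qed

lemma acute_triangle_aff_dim: "acute_triangle K \<Longrightarrow> aff_dim K = 2"
  by (simp add: acute_triangle_def aff_dim_simplex)

lemma acute_triangle_convex: "acute_triangle K \<Longrightarrow> convex K"
  by (auto simp: acute_triangle_def convex_simplex)

lemma acute_triangle_compact: "acute_triangle K \<Longrightarrow> compact K"
  by (auto simp: acute_triangle_def compact_simplex)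

lemma acute_triangle_interior:
  assumes "acute_triangle K"
  shows "interior K \<noteq> {}"
proof -
  have "rel_interior K \<noteq> {}"
    using assms acute_triangle_aff_dim[OF assms] rel_interior_eq_empty[OF acute_triangle_convex]
    by (metis aff_dim_empty aff_dim_negative_iff not_less zero_le_numeral)
  moreover have "affine hull K = UNIV"
    using acute_triangle_aff_dim[OF assms] aff_dim_eq_full[of K] by simp
  ultimately show ?thesis
    using rel_interior_interior by blast
qed

text \<open>Allows the factor \<open>1 / area K\<close> to be cancelled in the form.\<close>

lemma acute_triangle_area_pos:
  assumes "acute_triangle K"
  shows "area K > 0"
proof -
  have "K \<in> lmeasurable"
    using acute_triangle_compact[OF assms] by (rule lmeasurable_compact)
  moreover have "\<not> negligible K"
    using acute_triangle_interior[OF assms] acute_triangle_convex[OF assms]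
    by (simp add: negligible_convex_interior)
  ultimately show ?thesis
    unfolding area_def by (metis negligible_iff_measure0 measure_nonneg less_eq_real_def)
qed

text \<open>A face strictly between an edge and its triangle is excluded by dimension.\<close>

lemma mesh_shared_edge:
  assumes mesh: "acute_mesh \<Omega> T" and K: "K \<in> T" "\<sigma> \<in> edges K"
    and L: "L \<in> T" "L \<noteq> K" and x: "x \<in> rel_interior \<sigma>" "x \<in> L"
  shows "K \<inter> L = \<sigma>"
proof -
  have tK: "acute_triangle K" and tL: "acute_triangle L"
    using mesh K L by (auto simp: acute_mesh_def)
  note faces = mesh_intersection_face[OF mesh K(1) L(1)]
  have \<sigma>: "\<sigma> face_of K" "aff_dim \<sigma> = 1"
    using K(2) by (auto simp: edges_def edge_of_def)
  have "x \<in> K"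
    using x(1) \<sigma>(1) face_of_imp_subset rel_interior_subset by blast
  \<comment> \<open>A face that meets the relative interior of \<open>\<sigma>\<close> contains all
    of \<open>\<sigma>\<close>.\<close>
  then have sub: "\<sigma> \<subseteq> K \<inter> L"
    using subset_of_face_of[OF faces(1), of \<sigma>] x \<sigma>(1) face_of_imp_subset by blast
  have "K \<inter> L \<noteq> K"
  proof
    assume "K \<inter> L = K"
    then have "K face_of L" using faces(2) by simp
    then have "aff_dim K < aff_dim L"
      using face_of_aff_dim_lt[of L K] L(2) acute_triangle_convex[OF tL] by blast
    then show False
      by (simp add: acute_triangle_aff_dim tK tL)
  qed
  then have "aff_dim (K \<inter> L) < 2"
    using face_of_aff_dim_lt[OF acute_triangle_convex[OF tK] faces(1)]
    by (simp add: acute_triangle_aff_dim tK)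
  moreover have "\<sigma> face_of K \<inter> L"
    using \<sigma>(1) sub by (meson face_of_subset inf_le1)
  moreover have "convex (K \<inter> L)"
    using tK tL by (simp add: acute_triangle_convex convex_Int)
  ultimately show ?thesis
    using face_of_aff_dim_lt[of "K \<inter> L" \<sigma>] \<sigma>(2) by fastforce
qed

text \<open>The midpoint of the common edge is a relative interior point lying in both triangles, so
  they meet exactly in that edge, and their remaining vertices are separated by it.\<close>

lemma mesh_edge_two_sides:
  assumes mesh: "acute_mesh \<Omega> T" and "K \<in> T" "L \<in> T" "L \<noteq> K"
    and "\<sigma> \<in> edges K" "\<sigma> \<in> edges L"
  obtains a b c d where "\<sigma> = closed_segment a b" "K = convex hull {a, b, c}"
    "L = convex hull {a, b, d}"
    "cross2 (b - a) (c - a) * cross2 (b - a) (d - a) < 0"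
proof -
  have tK: "acute_triangle K" and tL: "acute_triangle L"
    using assms by (auto simp: acute_mesh_def)
  obtain a b c where K: "K = convex hull {a, b, c}" "\<sigma> = closed_segment a b"
    and c: "cross2 (b - a) (c - a) \<noteq> 0"
    using acute_triangle_edge[OF tK assms(5)] .
  obtain a' b' d where L': "L = convex hull {a', b', d}" "\<sigma> = closed_segment a' b'"
    and d': "cross2 (b' - a') (d - a') \<noteq> 0"
    using acute_triangle_edge[OF tL assms(6)] .
  have ab: "{a, b} = {a', b'}"
    using K(2) L'(2) by (metis closed_segment_eq)
  then have L: "L = convex hull {a, b, d}"
    using L'(1) by (metis insert_commute insert_is_Un sup_assoc)
  \<comment> \<open>Exchanging the endpoints only changes the sign of the determinant.\<close>
  have d: "cross2 (b - a) (d - a) \<noteq> 0"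
    using ab d' by (auto simp: doubleton_eq_iff cross2_def algebra_simps)
  have "a \<noteq> b" using c by (auto simp: cross2_def)
  then have "midpoint a b \<in> rel_interior \<sigma>"
    by (simp add: K(2) rel_interior_closed_segment)
  moreover then have "midpoint a b \<in> L"
    using assms(6) rel_interior_subset face_of_imp_subset
    by (fastforce simp: edges_def edge_of_def)
  ultimately have "K \<inter> L = \<sigma>"
    using mesh_shared_edge[OF assms(1,2,5,3,4)] by blast
  then have "cross2 (b - a) (c - a) * cross2 (b - a) (d - a) < 0"
    using K L c d by (intro adjacent_triangles_opposite_sides) auto
  then show ?thesis
    using that K L by blast
qed

text \<open>The explicit normals on \<open>\<sigma>\<close> differ only in the sign of the oriented
  area, and the third vertices lie on opposite sides.\<close>

lemma mesh_outer_normal_opposite: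
  assumes "acute_mesh \<Omega> T" and "K \<in> T" "L \<in> T" "L \<noteq> K" "\<sigma> \<in> edges K" "\<sigma> \<in> edges L"
  shows "outer_normal L \<sigma> = - outer_normal K \<sigma>"
proof -
  obtain a b c d where *: "\<sigma> = closed_segment a b" "K = convex hull {a, b, c}"
    "L = convex hull {a, b, d}"
    and neg: "cross2 (b - a) (c - a) * cross2 (b - a) (d - a) < 0"
    using mesh_edge_two_sides[OF assms] .
  have "sgn (cross2 (b - a) (d - a)) = - sgn (cross2 (b - a) (c - a))"
    using neg by (auto simp: mult_less_0_iff)
  moreover have "cross2 (b - a) (c - a) \<noteq> 0" "cross2 (b - a) (d - a) \<noteq> 0"
    using neg by auto
  ultimately show ?thesis
    by (simp add: * outer_normal_triangle)
qed

lemma norm_outer_normal: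
  assumes "acute_triangle K" "\<sigma> \<in> edges K"
  shows "norm (outer_normal K \<sigma>) = 1"
proof -
  obtain a b c where K: "K = convex hull {a, b, c}" "\<sigma> = closed_segment a b"
    and c: "cross2 (b - a) (c - a) \<noteq> 0"
    using acute_triangle_edge[OF assms] .
  have "a \<noteq> b" using c by (auto simp: cross2_def)
  with c show ?thesis
    by (simp add: K outer_normal_triangle abs_sgn_eq)
qed

text \<open>If \<open>K\<close> were the only triangle at a point of the open edge, that point would be interior to \<open>K\<close>.\<close>

lemma mesh_neighbour_exists:
  assumes mesh: "acute_mesh \<Omega> T" and "open \<Omega>" and K: "K \<in> T"
    and \<sigma>: "\<sigma> \<in> edges K" "\<sigma> \<in> interior_edges \<Omega> T"
  shows "\<exists>L\<in>T. L \<noteq> K \<and> \<sigma> \<in> edges L"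
proof -
  have tri: "acute_triangle M" if "M \<in> T" for M
    using that mesh by (auto simp: acute_mesh_def)
  have face: "\<sigma> face_of K" "aff_dim \<sigma> = 1"
    using \<sigma>(1) by (auto simp: edges_def edge_of_def)
  then have "rel_interior \<sigma> \<noteq> {}"
    using face_of_imp_convex rel_interior_eq_empty[of \<sigma>] by fastforce
  then obtain x where x: "x \<in> rel_interior \<sigma>" by blast
  have "x \<in> \<Omega>" using x \<sigma>(2) by (auto simp: interior_edges_def)
  have "\<exists>L\<in>T - {K}. x \<in> L"
  proof (rule ccontr)
    assume no: "\<not> (\<exists>L\<in>T - {K}. x \<in> L)"
    have "finite T" using mesh by (simp add: acute_mesh_def triangulation_def)
    then have "closed (\<Union>(T - {K}))"
      using tri by (intro closed_Union) (auto intro: compact_imp_closed acute_triangle_compact)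
    then have "open (\<Omega> - \<Union>(T - {K}))"
      using \<open>open \<Omega>\<close> by blast
    moreover have "\<Omega> - \<Union>(T - {K}) \<subseteq> K"
      using mesh closure_subset[of \<Omega>] by (auto simp: acute_mesh_def)
    moreover have "x \<in> \<Omega> - \<Union>(T - {K})"
      using \<open>x \<in> \<Omega>\<close> no by blast
    ultimately have "x \<in> interior K"
      by (meson interiorI)
    moreover have "\<sigma> \<noteq> K"
      using face(2) acute_triangle_aff_dim[OF tri[OF K]] by auto
    then have "\<sigma> \<inter> interior K = {}"
      using face_of_disjoint_interior[OF face(1)] by blast
    ultimately show False
      using x rel_interior_subset by blast
  qed
  then obtain L where L: "L \<in> T" "L \<noteq> K" "x \<in> L" by blast
  then have "K \<inter> L = \<sigma>"
    using mesh_shared_edge[OF mesh K \<sigma>(1)] x by blast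
  then have "\<sigma> \<in> edges L"
    using mesh_intersection_face(2)[OF mesh K L(1)] face(2) by (simp add: edges_def edge_of_def)
  with L show ?thesis by blast
qed

text \<open>Three triangles at one edge would have pairwise opposite normals there; such a normal
  equals its own negative, contradicting its unit length.\<close>

lemma mesh_neighbour_unique:
  assumes mesh: "acute_mesh \<Omega> T" and K: "K \<in> T" "\<sigma> \<in> edges K"
    and L: "L \<in> T" "L \<noteq> K" "\<sigma> \<in> edges L"
  shows "neighbour T K \<sigma> = L"
  unfolding neighbour_def
proof (rule the_equality)
  fix M assume M: "M \<in> T \<and> M \<noteq> K \<and> \<sigma> \<in> edges M"
  show "M = L"
  proof (rule ccontr)
    assume "M \<noteq> L"
    then have "outer_normal M \<sigma> = - outer_normal L \<sigma>"
      using mesh_outer_normal_opposite[OF mesh L(1)] L M by blast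
    moreover have "outer_normal M \<sigma> = - outer_normal K \<sigma>"
      using mesh_outer_normal_opposite[OF mesh K(1)] K M by blast
    moreover have "outer_normal L \<sigma> = - outer_normal K \<sigma>"
      using mesh_outer_normal_opposite[OF mesh K(1)] K L by blast
    ultimately have "outer_normal K \<sigma> = - outer_normal K \<sigma>" by simp
    then have "outer_normal K \<sigma> = 0"
      by (simp add: vec_eq_iff eq_neg_iff_add_eq_0)
    moreover have "acute_triangle K" using mesh K by (simp add: acute_mesh_def)
    ultimately show False
      using norm_outer_normal[OF _ K(2)] by simp
  qed
qed (use L in simp)

text \<open>Makes the passage from \<open>(K, \<sigma>)\<close> to
  \<open>(neighbour T K \<sigma>, \<sigma>)\<close> an involution on pairs with
  \<open>\<sigma>\<close> an interior edge.\<close>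

lemma mesh_neighbour:
  assumes "acute_mesh \<Omega> T" "open \<Omega>" "K \<in> T" "\<sigma> \<in> edges K \<inter> interior_edges \<Omega> T"
  shows "neighbour T K \<sigma> \<in> T" "neighbour T K \<sigma> \<noteq> K" "\<sigma> \<in> edges (neighbour T K \<sigma>)"
    "neighbour T (neighbour T K \<sigma>) \<sigma> = K"
proof -
  obtain L where "L \<in> T" "L \<noteq> K" "\<sigma> \<in> edges L"
    using mesh_neighbour_exists assms by blast
  moreover from this have "neighbour T K \<sigma> = L" "neighbour T L \<sigma> = K"
    using assms mesh_neighbour_unique[OF assms(1)] by auto
  ultimately show "neighbour T K \<sigma> \<in> T" "neighbour T K \<sigma> \<noteq> K"
    "\<sigma> \<in> edges (neighbour T K \<sigma>)" "neighbour T (neighbour T K \<sigma>) \<sigma> = K"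
    by auto
qed


section \<open>Fluxes of Raviart-Thomas fields\<close>

text \<open>A short step in any direction stays in \<open>S\<close>, so the linear parts agree in
  every direction. This gives the uniqueness behind \<open>cell_restr\<close>.\<close>

lemma affine_map_eq_on_open:
  assumes "affine_map g" "affine_map h" "open S" "S \<noteq> {}" "\<And>x. x \<in> S \<Longrightarrow> g x = h x"
  shows "g = h"
proof -
  obtain A p B q where A: "linear A" "\<And>x. g x = A x + p" and B: "linear B" "\<And>x. h x = B x + q"
    using assms(1,2) unfolding affine_map_def by auto
  obtain x where x: "x \<in> S" using assms(4) by blast
  then obtain e where e: "e > 0" "ball x e \<subseteq> S"
    using assms(3) by (meson openE)
  have AB: "A y = B y" for y
  proof (cases "y = 0")
    case False
    define t where "t = e / (2 * norm y)"
    have t: "t > 0" using False e by (simp add: t_def)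
    have "norm (t *\<^sub>R y) < e" using False e by (simp add: t_def)
    then have "x + t *\<^sub>R y \<in> S" using e by (auto simp: dist_norm)
    then have "g (x + t *\<^sub>R y) - g x = h (x + t *\<^sub>R y) - h x"
      using assms(5) x by simp
    then have "t *\<^sub>R A y = t *\<^sub>R B y"
      by (simp add: A(2) B(2) linear_add[OF A(1)] linear_add[OF B(1)]
          linear_scale[OF A(1)] linear_scale[OF B(1)])
    then show ?thesis using t by simp
  qed (simp add: linear_0 A B)
  moreover have "p = q"
    using assms(5)[OF x] AB[of x] A B by simp
  ultimately show ?thesis
    using A B by auto
qed

lemma cell_restr_eqI:
  assumes "affine_map g" "\<And>x. x \<in> interior K \<Longrightarrow> u x = g x" "interior K \<noteq> {}"
  shows "cell_restr u K = g"
  unfolding cell_restr_def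
proof (rule the_equality)
  fix h assume "affine_map h \<and> (\<forall>x\<in>interior K. u x = h x)"
  then show "h = g"
    using assms by (intro affine_map_eq_on_open[of h g "interior K"]) auto
qed (use assms in blast)

lemma divergence_affine:
  assumes "linear A" "open S" "x \<in> S" "\<And>y. y \<in> S \<Longrightarrow> u y = A y + z"
  shows "divergence u x = A (axis 1 1) $ 1 + A (axis 2 1) $ 2"
proof -
  have "((\<lambda>y. A y + z) has_derivative A) (at x)"
    using assms(1) by (auto intro!: derivative_eq_intros linear_imp_has_derivative)
  then have "(u has_derivative A) (at x)"
    using assms by (auto intro: has_derivative_transform_within_open)
  then have "frechet_derivative u (at x) = A"
    by (rule frechet_derivative_at[symmetric])
  then show ?thesis
    by (simp add: divergence_def sum_2)
qed

text \<open>Allows evaluation at any convenient point of the edge, in particular at its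
  midpoint.\<close>

lemma normal_comp_eq:
  assumes "u \<in> RT0 \<Omega> T" "K \<in> T" "\<sigma> \<in> edges K" "x \<in> \<sigma>"
  shows "normal_comp u K \<sigma> = cell_restr u K x \<bullet> outer_normal K \<sigma>"
proof -
  have "\<exists>c. \<forall>y\<in>\<sigma>. cell_restr u K y \<bullet> outer_normal K \<sigma> = c"
    using assms unfolding RT0_def by blast
  then obtain c where c: "\<forall>y\<in>\<sigma>. cell_restr u K y \<bullet> outer_normal K \<sigma> = c" ..
  then have "normal_comp u K \<sigma> = c"
    unfolding normal_comp_def using assms(4) by (intro the_equality) auto
  with c assms(4) show ?thesis by simp
qed

text \<open>The continuity condition in \<open>RT0\<close> uses the normal of \<open>K\<close> for
  both restrictions; passing to the neighbour's own normal reverses the sign.\<close>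

lemma normal_comp_neighbour:
  assumes "acute_mesh \<Omega> T" "open \<Omega>" "u \<in> RT0 \<Omega> T" "K \<in> T"
    and \<sigma>: "\<sigma> \<in> edges K \<inter> interior_edges \<Omega> T"
  shows "normal_comp u (neighbour T K \<sigma>) \<sigma> = - normal_comp u K \<sigma>"
proof -
  let ?L = "neighbour T K \<sigma>"
  note L = mesh_neighbour[OF assms(1,2,4,5)]
  have "aff_dim \<sigma> = 1" using \<sigma> by (auto simp: edges_def edge_of_def)
  then obtain x where x: "x \<in> \<sigma>" by fastforce
  have "normal_comp u K \<sigma> = cell_restr u ?L x \<bullet> outer_normal K \<sigma>"
    using normal_comp_eq[OF assms(3,4) _ x] \<sigma> x assms(3,4) unfolding RT0_def by auto
  moreover have "outer_normal ?L \<sigma> = - outer_normal K \<sigma>"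
    using mesh_outer_normal_opposite[OF assms(1,4) L(1,2)] L \<sigma> by blast
  ultimately show ?thesis
    using normal_comp_eq[OF assms(3) L(1,3) x] by simp
qed

text \<open>An open edge not contained in \<open>\<Omega>\<close> meets the boundary, possibly in a part of the edge only;
  since the normal component is constant on the edge, it vanishes there altogether.\<close>

lemma normal_comp_boundary:
  assumes "acute_mesh \<Omega> T" "open \<Omega>" "u \<in> RT0 \<Omega> T" "K \<in> T"
    and "\<sigma> \<in> edges K" "\<sigma> \<notin> interior_edges \<Omega> T"
  shows "normal_comp u K \<sigma> = 0"
proof -
  obtain x where x: "x \<in> rel_interior \<sigma>" "x \<notin> \<Omega>"
    using assms(4-6) by (auto simp: interior_edges_def)
  then have "x \<in> \<sigma>" using rel_interior_subset by blast
  then have "x \<in> K"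
    using assms(5) face_of_imp_subset by (auto simp: edges_def edge_of_def)
  then have "x \<in> closure \<Omega>"
    using assms(1,4) by (auto simp: acute_mesh_def)
  then have "x \<in> frontier \<Omega>"
    using x assms(2) by (simp add: frontier_def interior_open)
  then have "cell_restr u K x \<bullet> outer_normal K \<sigma> = 0"
    using x assms(3-5) unfolding RT0_def by blast
  then show ?thesis
    using normal_comp_eq[OF assms(3-5) \<open>x \<in> \<sigma>\<close>] by simp
qed

lemma finite_edges:
  assumes "acute_triangle K"
  shows "finite (edges K)"
  by (rule acute_triangle_imp_vertices[OF assms]) (simp add: edges_triangle)

text \<open>The constant normal components are evaluated at the edge midpoints, which turns the sum
  into the one in \<open>triangle_flux\<close>; the trace appearing there is the divergence at any
  interior point.\<close>

lemma cell_flux_nonneg: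
  assumes mesh: "acute_mesh \<Omega> T" and "u \<in> RT0 \<Omega> T" "div_nonneg T u" and K: "K \<in> T"
  shows "(\<Sum>\<sigma>\<in>edges K. edge_length \<sigma> * normal_comp u K \<sigma>) \<ge> 0"
proof -
  have tK: "acute_triangle K" using mesh K by (simp add: acute_mesh_def)
  obtain x where x: "x \<in> interior K"
    using acute_triangle_interior[OF tK] by blast
  have "\<exists>g. affine_map g \<and> (\<forall>x\<in>interior K. u x = g x)"
    using assms(2) K by (simp add: RT0_def)
  then obtain g where g: "affine_map g" "\<And>x. x \<in> interior K \<Longrightarrow> u x = g x"
    by blast
  then have restr: "cell_restr u K = g"
    using x by (intro cell_restr_eqI) auto
  obtain A z where A: "linear A" "\<And>x. g x = A x + z"
    using g(1) unfolding affine_map_def by auto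
  have "divergence u x = A (axis 1 1) $ 1 + A (axis 2 1) $ 2"
    using divergence_affine[OF A(1) open_interior x, of u z] A g by simp
  then have tr: "A (axis 1 1) $ 1 + A (axis 2 1) $ 2 \<ge> 0"
    using assms(3) K x unfolding div_nonneg_def by metis
  obtain a b c where abc: "K = convex hull {a, b, c}" and D: "cross2 (b - a) (c - a) \<noteq> 0"
    using acute_triangle_imp_vertices[OF tK] .
  define f where "f = (\<lambda>p q r. edge_length (closed_segment p q) *
      (g (midpoint p q) \<bullet> outer_normal (convex hull {p, q, r}) (closed_segment p q)))"
  have perm: "{b, c, a} = {a, b, c}" "{c, a, b} = {a, b, c}" by auto
  note edges = edges_triangle[OF D, folded abc]
  have comp: "normal_comp u K (closed_segment p q) =
      g (midpoint p q) \<bullet> outer_normal K (closed_segment p q)"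
    if "closed_segment p q \<in> edges K" for p q
    using normal_comp_eq[OF assms(2) K that] by (simp add: restr)
  note ne = affine_independent_triangle[OF D]
  \<comment> \<open>The sum runs over a set of edges, so three summands require three different
    segments.\<close>
  have distinct: "closed_segment a b \<noteq> closed_segment b c" "closed_segment a b \<noteq> closed_segment c a"
    "closed_segment b c \<noteq> closed_segment c a"
    using ne by (auto simp: closed_segment_eq doubleton_eq_iff)
  have "(\<Sum>\<sigma>\<in>edges K. edge_length \<sigma> * normal_comp u K \<sigma>) = f a b c + f b c a + f c a b"
    using distinct comp by (simp add: edges f_def perm abc[symmetric])
  also have "\<dots> = \<bar>cross2 (b - a) (c - a)\<bar> / 2 * (A (axis 1 1) $ 1 + A (axis 2 1) $ 2)"
    by (rule triangle_flux[OF A D f_def])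
  also have "\<dots> \<ge> 0"
    using tr by (intro mult_nonneg_nonneg) auto
  finally show ?thesis .
qed


section \<open>Nonnegativity of the upwind form\<close>

text \<open>Multiplication by \<open>min f 0 \<le> 0\<close> reverses the upper bound for
  \<open>p \<bullet> q\<close>; the rest is the splitting of \<open>f\<close> into its positive and
  negative parts.\<close>

lemma upwind_term_bound:
  fixes p q :: "'a::real_inner"
  shows "max f 0 * (p \<bullet> p) + min f 0 * (p \<bullet> q) \<ge>
    (f * (p \<bullet> p) + max f 0 * (p \<bullet> p) + min f 0 * (q \<bullet> q)) / 2"
proof -
  have "(p - q) \<bullet> (p - q) \<ge> 0" by simp
  then have "p \<bullet> q \<le> (p \<bullet> p + q \<bullet> q) / 2"
    by (simp add: inner_diff_left inner_diff_right inner_commute)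
  then have "min f 0 * (p \<bullet> q) \<ge> min f 0 * ((p \<bullet> p + q \<bullet> q) / 2)"
    by (intro mult_left_mono_neg) auto
  moreover have "f = max f 0 + min f 0" by simp
  then have "f * (p \<bullet> p) = max f 0 * (p \<bullet> p) + min f 0 * (p \<bullet> p)"
    by (metis distrib_right)
  ultimately show ?thesis
    by (simp add: algebra_simps add_divide_distrib)
qed

theorem proposition4p2:
  fixes \<Omega> :: "(real ^ 2) set" and T :: "(real ^ 2) set set"
    and u :: "real ^ 2 \<Rightarrow> real ^ 2"
  assumes "polygonal_domain \<Omega>" and "bounded \<Omega>"
    and "acute_mesh \<Omega> T"
    and "u \<in> RT0 \<Omega> T"
    and "div_nonneg T u"
  shows "\<forall>v \<in> P0 T. upwind_form \<Omega> T u v v \<ge> 0"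
proof
  fix v assume "v \<in> P0 T"
  have op: "open \<Omega>" using assms(1) by (simp add: polygonal_domain_def)
  have tri: "acute_triangle K" if "K \<in> T" for K
    using that assms(3) by (simp add: acute_mesh_def)
  have fin: "finite T" using assms(3) by (simp add: acute_mesh_def triangulation_def)
  define E where "E K = edges K \<inter> interior_edges \<Omega> T" for K
  have finE: "finite (E K)" if "K \<in> T" for K
    using finite_edges[OF tri[OF that]] by (simp add: E_def)
  define F where "F K \<sigma> = normal_comp u K \<sigma>" for K \<sigma>
  define N where "N K \<sigma> = neighbour T K \<sigma>" for K \<sigma>
  define V where "V K = cell_value v K" for K
  define S where "S K = (\<Sum>\<sigma>\<in>E K. edge_length \<sigma> * F K \<sigma>)" for K
  \<comment> \<open>\<open>P\<close> weights the outflow with the value of \<open>K\<close> itself,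
    \<open>M\<close> the inflow with the value of the neighbour.\<close>
  define P where "P K \<sigma> = edge_length \<sigma> * (max (F K \<sigma>) 0 * (V K \<bullet> V K))" for K \<sigma>
  define M where "M K \<sigma> = edge_length \<sigma> * (min (F K \<sigma>) 0 * (V (N K \<sigma>) \<bullet> V (N K \<sigma>)))" for K \<sigma>

  have len: "edge_length \<sigma> \<ge> 0" if "K \<in> T" "\<sigma> \<in> E K" for K \<sigma>
    using acute_triangle_edge[OF tri[OF that(1)], of \<sigma>] that(2)
    by (metis E_def IntD1 edge_length_segment norm_ge_zero)
  have S: "S K \<ge> 0" if "K \<in> T" for K
  proof -
    \<comment> \<open>Edges outside \<open>E K\<close> carry no flux, so the sum over interior edges
      is the total flux out of \<open>K\<close>.\<close>
    have "S K = (\<Sum>\<sigma>\<in>edges K. edge_length \<sigma> * F K \<sigma>)"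
      unfolding S_def
      using normal_comp_boundary[OF assms(3) op assms(4) that] finite_edges[OF tri[OF that]]
      by (intro sum.mono_neutral_left) (auto simp: E_def F_def)
    then show ?thesis
      using cell_flux_nonneg[OF assms(3,4,5) that] by (simp add: F_def)
  qed
  have swap: "(\<Sum>(K, \<sigma>)\<in>Sigma T E. M K \<sigma>) = (\<Sum>(K, \<sigma>)\<in>Sigma T E. - P K \<sigma>)"
  \<comment> \<open>The exchange of the two triangles at an edge is its own inverse, hence serves as
    both witnesses.\<close>
  proof (rule sum.reindex_bij_witness[of _ "\<lambda>(K, \<sigma>). (N K \<sigma>, \<sigma>)" "\<lambda>(K, \<sigma>). (N K \<sigma>, \<sigma>)"])
    fix e assume "e \<in> Sigma T E"
    then obtain K \<sigma> where e: "e = (K, \<sigma>)" "K \<in> T" "\<sigma> \<in> edges K \<inter> interior_edges \<Omega> T"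
      by (auto simp: E_def)
    note L = mesh_neighbour[OF assms(3) op e(2,3)]
    show "(case case e of (K, \<sigma>) \<Rightarrow> (N K \<sigma>, \<sigma>) of (K, \<sigma>) \<Rightarrow> (N K \<sigma>, \<sigma>)) = e"
      and "(case case e of (K, \<sigma>) \<Rightarrow> (N K \<sigma>, \<sigma>) of (K, \<sigma>) \<Rightarrow> (N K \<sigma>, \<sigma>)) = e"
      and "(case e of (K, \<sigma>) \<Rightarrow> (N K \<sigma>, \<sigma>)) \<in> Sigma T E"
      and "(case e of (K, \<sigma>) \<Rightarrow> (N K \<sigma>, \<sigma>)) \<in> Sigma T E"
      using L e by (auto simp: N_def E_def)
    have "F (N K \<sigma>) \<sigma> = - F K \<sigma>"
      using normal_comp_neighbour[OF assms(3) op assms(4) e(2,3)] by (simp add: F_def N_def)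
    moreover have "max (- F K \<sigma>) 0 = - min (F K \<sigma>) 0" by simp
    ultimately show "(case case e of (K, \<sigma>) \<Rightarrow> (N K \<sigma>, \<sigma>) of (K, \<sigma>) \<Rightarrow> - P K \<sigma>) =
        (case e of (K, \<sigma>) \<Rightarrow> M K \<sigma>)"
      by (simp add: e(1) P_def M_def)
  qed
  have "0 \<le> (\<Sum>K\<in>T. S K * (V K \<bullet> V K)) / 2"
    using S by (simp add: sum_nonneg)
  \<comment> \<open>By \<open>swap\<close> the two added sums cancel; they supply the terms needed
    for the edgewise bound.\<close>
  also have "\<dots> = ((\<Sum>K\<in>T. S K * (V K \<bullet> V K)) +
      ((\<Sum>(K, \<sigma>)\<in>Sigma T E. P K \<sigma>) + (\<Sum>(K, \<sigma>)\<in>Sigma T E. M K \<sigma>))) / 2"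
    unfolding swap by (simp add: split_def sum_negf)
  also have "\<dots> = (\<Sum>K\<in>T. \<Sum>\<sigma>\<in>E K.
      (edge_length \<sigma> * (F K \<sigma> * (V K \<bullet> V K)) + P K \<sigma> + M K \<sigma>) / 2)"
    using finE by (simp add: sum.Sigma[OF fin, symmetric] S_def sum_distrib_right
        sum.distrib sum_divide_distrib add_divide_distrib mult.assoc)
  also have "\<dots> \<le> (\<Sum>K\<in>T. \<Sum>\<sigma>\<in>E K. edge_length \<sigma> *
      (max (F K \<sigma>) 0 * (V K \<bullet> V K) + min (F K \<sigma>) 0 * (V K \<bullet> V (N K \<sigma>))))"
  proof (intro sum_mono)
    fix K \<sigma> assume K: "K \<in> T" "\<sigma> \<in> E K"
    show "(edge_length \<sigma> * (F K \<sigma> * (V K \<bullet> V K)) + P K \<sigma> + M K \<sigma>) / 2 \<le> edge_length \<sigma> *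
      (max (F K \<sigma>) 0 * (V K \<bullet> V K) + min (F K \<sigma>) 0 * (V K \<bullet> V (N K \<sigma>)))"
      using mult_left_mono[OF upwind_term_bound[of "F K \<sigma>" "V K" "V (N K \<sigma>)"] len[OF K]]
      by (simp add: P_def M_def distrib_left)
  qed
  also have "\<dots> = upwind_form \<Omega> T u v v"
    unfolding upwind_form_def upwind_conv_def
    using acute_triangle_area_pos tri
    by (intro sum.cong) (auto simp: E_def F_def V_def N_def inner_sum_right inner_add_right
        less_imp_neq[symmetric])
  finally show "upwind_form \<Omega> T u v v \<ge> 0" .
qed

end
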